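(* Let $\boldsymbol\mu>\mathbf 0$, assume every matrix in $\mathcal Z(\boldsymbol\mu)$ is irreducible, and assume $\mathcal Z(\boldsymbol\mu)$ is a primitive set. For the iteration started from an arbitrary $\mathbf p^{(0)}>\mathbf 0$ — namely $y_i^{(k)}=\max_{k_i\in\mathcal K_i}\big(\mathbf e_i^T-\mathbf a_i^{k_i}(\boldsymbol\mu)\big)\mathbf p^{(k)}$, $\beta^{(k)}=\min_i p_i^{(k)}/y_i^{(k)}$, $\mathbf p^{(k+1)}=\mathbf y^{(k)}/\|\mathbf y^{(k)}\|$ — the sequence $\beta^{(k)}$ converges to $\beta^*=1/\max_{\mathbf Z\in\mathcal Z(\boldsymbol\mu)}\lambda(\mathbf Z)$, and $\mathbf p^{(k)}$ converges to a vector $\mathbf p^*$ such that $\lim_{\alpha\to\infty}\Gamma(\alpha\mathbf p^* )=\beta^*\boldsymbol\mu$.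
   Context: Multicast system: $N$ transmitters $T_1,\dots,T_N$; transmitter $T_i$ has $K_i\geq1$ receivers $R_i^{k}$, $k\in\mathcal K_i=\{1,\dots,K_i\}$. Channel gains $g_{r_i^{k},t_j}\geq 0$ (from $T_j$ to $R_i^k$) with $g_{r_i^{k},t_i}>0$; noise variance $\sigma^2>0$. SINR: $\gamma_i^{k}(\mathbf p)=\frac{g_{r_i^{k},t_i}p_i}{\sum_{j\neq i}g_{r_i^{k},t_j}p_j+\sigma^2}$, $\gamma_i(\mathbf p)=\min_{k\in\mathcal K_i}\gamma_i^k(\mathbf p)$, $\Gamma(\mathbf p)=(\gamma_1(\mathbf p),\dots,\gamma_N(\mathbf p))$. For $\boldsymbol\mu\in\mathbb R^N$, $\mathbf a_i^{k}(\boldsymbol\mu)\in\mathbb R^{1\times N}$ is the row vector with $i$-th entry $1$ and $j$-th entry $-\mu_i g_{r_i^{k},t_j}/g_{r_i^{k},t_i}$ for $j\neq i$. $\mathcal G(\boldsymbol\mu)$ is the set of $N\times N$ matrices whose $i$-th row is $\mathbf a_i^{k_i}(\boldsymbol\mu)$ for some $k_i\in\mathcal K_i$; $\mathcal Z(\boldsymbol\mu)=\{\mathbf I-\mathbf G:\mathbf G\in\mathcal G(\boldsymbol\mu)\}$. A finite set $\mathcal Z$ of nonnegative $N\times N$ matrices is primitive if there is a positive integer $n$ such that every product of $n$ matrices from $\mathcal Z$ (any order, repetitions allowed) has all entries positive. $\mathbf e_i$ is the $i$-th standard basis vector, $\|\cdot\|$ the Euclidean norm, $\lambda(\cdot)$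 the Perron–Frobenius eigenvalue (spectral radius). *)

theory Defs
  imports "HOL-Analysis.Analysis"
begin

text \<open>Indices of transmitters: a finite type 'n (N = CARD('n)).
  Receivers of transmitter i: indices k < K i (0-based), K i \<ge> 1.
  g i k j : channel gain from T_j to receiver R_i^k.\<close>

text \<open>Row vector a_i^k(mu).\<close>
definition a_row :: "('n::finite \<Rightarrow> nat \<Rightarrow> 'n \<Rightarrow> real) \<Rightarrow> real^'n \<Rightarrow> 'n \<Rightarrow> nat \<Rightarrow> real^'n" where
  "a_row g mu i k = (\<chi> j. if j = i then 1 else - (mu $ i) * g i k j / g i k i)"

definition unit_vec :: "'n::finite \<Rightarrow> real^'n" where
  "unit_vec i = (\<chi> j. if j = i then 1 else 0)"

text \<open>The set G(mu).\<close>
definition Gset :: "('n::finite \<Rightarrow> nat) \<Rightarrow> ('n \<Rightarrow> nat \<Rightarrow> 'n \<Rightarrow> real) \<Rightarrow> real^'n \<Rightarrow> (real^'n^'n) set" where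
  "Gset K g mu = {(\<chi> i. a_row g mu i (\<kappa> i)) | \<kappa>. \<forall>i. \<kappa> i < K i}"

text \<open>The set Z(mu) = {I - G | G in G(mu)}.\<close>
definition Zset :: "('n::finite \<Rightarrow> nat) \<Rightarrow> ('n \<Rightarrow> nat \<Rightarrow> 'n \<Rightarrow> real) \<Rightarrow> real^'n \<Rightarrow> (real^'n^'n) set" where
  "Zset K g mu = {mat 1 - G | G. G \<in> Gset K g mu}"

text \<open>Irreducible (nonnegative) matrix: its directed graph (edge i\<rightarrow>j iff A_ij \<noteq> 0)
  is strongly connected.\<close>
definition irreducible_mat :: "real^'n^'n \<Rightarrow> bool" where
  "irreducible_mat A \<longleftrightarrow> (\<forall>i j. i \<noteq> j \<longrightarrow> (i, j) \<in> {(i, j). A $ i $ j \<noteq> 0}\<^sup>+)"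

text \<open>Primitive finite set of nonnegative matrices.\<close>
definition primitive_set :: "(real^'n^'n) set \<Rightarrow> bool" where
  "primitive_set Z \<longleftrightarrow> (\<exists>n::nat. n > 0 \<and>
     (\<forall>Ms. length Ms = n \<and> set Ms \<subseteq> Z \<longrightarrow> (\<forall>i j. foldr (**) Ms (mat 1) $ i $ j > 0)))"

text \<open>Spectral radius: maximal modulus of a (complex) eigenvalue.\<close>
definition spectral_radius :: "real^'n::finite^'n \<Rightarrow> real" where
  "spectral_radius A = Sup (cmod ` {c. \<exists>v::complex^'n. v \<noteq> 0 \<and>
      (\<chi> i j. complex_of_real (A $ i $ j)) *v v = c *s v})"

text \<open>SINR.\<close>
definition sinr_k :: "('n::finite \<Rightarrow> nat \<Rightarrow> 'n \<Rightarrow> real) \<Rightarrow> real \<Rightarrow> real^'n \<Rightarrow> 'n \<Rightarrow> nat \<Rightarrow> real" where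
  "sinr_k g sigma2 p i k = g i k i * p $ i / ((\<Sum>j\<in>UNIV - {i}. g i k j * p $ j) + sigma2)"

definition sinr :: "('n::finite \<Rightarrow> nat) \<Rightarrow> ('n \<Rightarrow> nat \<Rightarrow> 'n \<Rightarrow> real) \<Rightarrow> real \<Rightarrow> real^'n \<Rightarrow> 'n \<Rightarrow> real" where
  "sinr K g sigma2 p i = Min ((sinr_k g sigma2 p i) ` {..<K i})"

definition Gamma :: "('n::finite \<Rightarrow> nat) \<Rightarrow> ('n \<Rightarrow> nat \<Rightarrow> 'n \<Rightarrow> real) \<Rightarrow> real \<Rightarrow> real^'n \<Rightarrow> real^'n" where
  "Gamma K g sigma2 p = (\<chi> i. sinr K g sigma2 p i)"

text \<open>The iteration map: y_i = max_k (e_i^T - a_i^k(mu)) p.\<close>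
definition yvec :: "('n::finite \<Rightarrow> nat) \<Rightarrow> ('n \<Rightarrow> nat \<Rightarrow> 'n \<Rightarrow> real) \<Rightarrow> real^'n \<Rightarrow> real^'n \<Rightarrow> real^'n" where
  "yvec K g mu p = (\<chi> i. Max ((\<lambda>k. (unit_vec i - a_row g mu i k) \<bullet> p) ` {..<K i}))"

definition beta_of :: "('n::finite \<Rightarrow> nat) \<Rightarrow> ('n \<Rightarrow> nat \<Rightarrow> 'n \<Rightarrow> real) \<Rightarrow> real^'n \<Rightarrow> real^'n \<Rightarrow> real" where
  "beta_of K g mu p = Min ((\<lambda>i. p $ i / yvec K g mu p $ i) ` UNIV)"

end

theory Submission
  imports Defs "HOL-Real_Asymp.Real_Asymp"
begin

text \<open>Write \<open>y\<close> for the iteration map. As \<open>Z(\<mu>)\<close> chooses the receiver of every row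
  independently, \<open>y(x)\<close> is the row-wise maximum of \<open>Z x\<close> over \<open>Z \<in> Z(\<mu>)\<close> and is attained
  by a single matrix. So \<open>y\<close> is monotone and positively homogeneous, and its \<open>n\<close>-th iterate
  acts like a product of \<open>n\<close> matrices from \<open>Z(\<mu>)\<close>, which is entrywise positive by primitivity.
  Along the iteration the Collatz--Wielandt bounds \<open>min\<^sub>i y\<^sub>i(x)/x\<^sub>i \<le> max\<^sub>i y\<^sub>i(x)/x\<^sub>i\<close> move
  towards each other, and every \<open>n\<close> steps their gap shrinks by the factor \<open>1 - c/C\<close>, where
  \<open>c\<close> and \<open>C\<close> are the smallest and largest entries of such products. Hence both bounds tend
  to some \<open>\<rho> > 0\<close>, the logarithms of the components of the iterates change by a summable
  amount, and the iterates converge to a positive \<open>p\<^sup>*\<close> with \<open>y(p\<^sup>*) = \<rho> p\<^sup>*\<close>. The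
  Collatz--Wielandt bound identifies \<open>\<rho>\<close> as the largest spectral radius in \<open>Z(\<mu>)\<close>, and
  \<open>\<beta>\<close> is the reciprocal of the upper bound. Finally, as \<open>\<alpha> \<rightarrow> \<infinity>\<close> the noise becomes negligible
  and the worst receiver of transmitter \<open>i\<close> sees the SINR \<open>\<mu>\<^sub>i p\<^sup>*\<^sub>i / y\<^sub>i(p\<^sup>*) = \<mu>\<^sub>i / \<rho>\<close>.\<close>

lemma tendsto_Max_finite:
  fixes f :: "'a \<Rightarrow> 'b \<Rightarrow> real"
  assumes "finite A" "A \<noteq> {}" "\<And>a. a \<in> A \<Longrightarrow> (f a \<longlongrightarrow> l a) F"
  shows "((\<lambda>x. Max ((\<lambda>a. f a x) ` A)) \<longlongrightarrow> Max (l ` A)) F"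
  using assms
proof (induction A rule: finite_ne_induct)
  case (singleton a)
  then show ?case by simp
next
  case (insert a A)
  then have "((\<lambda>x. max (f a x) (Max ((\<lambda>a. f a x) ` A))) \<longlongrightarrow> max (l a) (Max (l ` A))) F"
    by (intro tendsto_max) auto
  with insert show ?case by simp
qed

lemma tendsto_Min_finite:
  fixes f :: "'a \<Rightarrow> 'b \<Rightarrow> real"
  assumes "finite A" "A \<noteq> {}" "\<And>a. a \<in> A \<Longrightarrow> (f a \<longlongrightarrow> l a) F"
  shows "((\<lambda>x. Min ((\<lambda>a. f a x) ` A)) \<longlongrightarrow> Min (l ` A)) F"
  using assms
proof (induction A rule: finite_ne_induct)
  case (singleton a)
  then show ?case by simp
next
  case (insert a A)
  then have "((\<lambda>x. min (f a x) (Min ((\<lambda>a. f a x) ` A))) \<longlongrightarrow> min (l a) (Min (l ` A))) F"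
    by (intro tendsto_min) auto
  with insert show ?case by simp
qed

lemma Min_divide_eq_divide_Max:
  fixes f :: "'a \<Rightarrow> real"
  assumes "finite A" "A \<noteq> {}" "\<And>a. a \<in> A \<Longrightarrow> f a > 0" "c \<ge> 0"
  shows "Min ((\<lambda>a. c / f a) ` A) = c / Max (f ` A)"
proof (rule Min_eqI)
  show "finite ((\<lambda>a. c / f a) ` A)"
    using assms(1) by simp
  have "Max (f ` A) \<in> f ` A"
    using assms(1,2) by simp
  then obtain a0 where "a0 \<in> A" "f a0 = Max (f ` A)"
    by auto
  then show "c / Max (f ` A) \<in> (\<lambda>a. c / f a) ` A"
    by (metis image_eqI)
  fix y
  assume "y \<in> (\<lambda>a. c / f a) ` A"
  then obtain a where a: "a \<in> A" "y = c / f a"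
    by blast
  have "f a \<le> Max (f ` A)"
    using a(1) assms(1) by simp
  moreover have "0 < Max (f ` A) * f a"
    using calculation assms(3)[OF a(1)] by simp
  ultimately show "c / Max (f ` A) \<le> y"
    using a(2) assms(4) by (simp add: divide_left_mono)
qed

lemma summable_if_contracting_after:
  fixes D :: "nat \<Rightarrow> real"
  assumes nonneg: "\<And>k. D k \<ge> 0" and "decseq D" and "n > 0"
    and theta: "0 \<le> \<theta>" "\<theta> < 1" and contract: "\<And>k. D (k + n) \<le> \<theta> * D k"
  shows "summable D"
proof -
  have D_mult: "D (q * n) \<le> \<theta> ^ q * D 0" for q
  proof (induction q)
    case (Suc q)
    have "D (Suc q * n) \<le> \<theta> * D (q * n)"
      using contract[of "q * n"] by (simp add: add.commute)
    also have "\<dots> \<le> \<theta> * (\<theta> ^ q * D 0)"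
      using Suc theta by (intro mult_left_mono) auto
    finally show ?case by simp
  qed simp
  \<comment> \<open>A positive factor, so that its \<open>n\<close>-th root gives a geometric bound for all \<open>k\<close>.\<close>
  define \<theta>' where "\<theta>' = max \<theta> (1/2)"
  define r where "r = root n \<theta>'"
  have \<theta>': "0 < \<theta>'" "\<theta>' < 1" "\<theta> \<le> \<theta>'"
    using theta by (auto simp: \<theta>'_def)
  have r: "0 < r" "r < 1" "r ^ n = \<theta>'"
    using \<theta>' \<open>n > 0\<close> by (auto simp: r_def real_root_pow_pos)
  have bound: "D k \<le> D 0 / \<theta>' * r ^ k" for k
  proof -
    define q where "q = k div n"
    have "D k \<le> D (q * n)"
      using \<open>decseq D\<close> by (simp add: decseq_def q_def div_times_less_eq_dividend)
    also have "\<dots> \<le> \<theta>' ^ q * D 0"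
      using D_mult[of q] \<theta>' theta nonneg[of 0]
      by (meson order_trans mult_right_mono power_mono)
    also have "\<dots> = r ^ (n * q) * D 0"
      using r by (simp add: power_mult)
    also have "\<dots> \<le> D 0 / \<theta>' * r ^ k"
    proof -
      have "r ^ k = r ^ (n * q) * r ^ (k mod n)"
        by (simp add: q_def flip: power_add)
      moreover have "r ^ n \<le> r ^ (k mod n)"
        using r \<open>n > 0\<close> by (intro power_decreasing) auto
      ultimately have "r ^ (n * q) * \<theta>' \<le> r ^ k"
        using r by (simp add: mult_left_mono)
      then have "r ^ (n * q) * \<theta>' * (D 0 / \<theta>') \<le> r ^ k * (D 0 / \<theta>')"
        using \<theta>' nonneg[of 0] by (intro mult_right_mono) auto
      then show ?thesis
        using \<theta>' by (simp add: ac_simps)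
    qed
    finally show ?thesis .
  qed
  have "summable (\<lambda>k. D 0 / \<theta>' * r ^ k)"
    using r by (intro summable_mult summable_geometric) simp
  then show ?thesis
    by (rule summable_comparison_test'[where N = 0]) (use bound nonneg in simp)
qed

lemma convergent_if_summable_ln_increments:
  fixes x :: "nat \<Rightarrow> real"
  assumes pos: "\<And>k. x k > 0" and "summable (\<lambda>k. ln (x (Suc k)) - ln (x k))"
  shows "\<exists>L>0. x \<longlonglongrightarrow> L"
proof -
  define s where "s = (\<Sum>k. ln (x (Suc k)) - ln (x k))"
  have "(\<lambda>k. \<Sum>j<k. ln (x (Suc j)) - ln (x j)) \<longlonglongrightarrow> s"
    unfolding s_def using assms(2) by (rule summable_LIMSEQ)
  then have "(\<lambda>k. ln (x k) - ln (x 0)) \<longlonglongrightarrow> s"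
    using sum_lessThan_telescope[of "\<lambda>j. ln (x j)"] by simp
  then have "(\<lambda>k. exp (ln (x k) - ln (x 0) + ln (x 0))) \<longlonglongrightarrow> exp (s + ln (x 0))"
    by (intro tendsto_exp tendsto_add tendsto_const)
  then show ?thesis
    using pos by (intro exI[of _ "exp (s + ln (x 0))"]) simp
qed

lemma abs_ln_le_ratio:
  fixes r m M :: real
  assumes "0 < m" "m \<le> M" "m / M \<le> r" "r \<le> M / m"
  shows "\<bar>ln r\<bar> \<le> M / m - 1"
proof -
  have "0 < r"
    using assms by (smt (verit) divide_pos_pos)
  then have "ln r \<le> ln (M / m)" "ln (m / M) \<le> ln r"
    using assms by simp_all
  moreover have "ln (m / M) = - ln (M / m)"
    using assms by (simp add: ln_div)
  moreover have "ln (M / m) \<le> M / m - 1"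
    using assms by (intro ln_le_minus_one) simp
  ultimately show ?thesis
    by linarith
qed

definition positive_vec :: "real^'n::finite \<Rightarrow> bool" where
  "positive_vec x \<longleftrightarrow> (\<forall>i. x $ i > 0)"

lemma positive_vec_scaleR: "positive_vec x \<Longrightarrow> t > 0 \<Longrightarrow> positive_vec (t *\<^sub>R x)"
  by (simp add: positive_vec_def)

lemma positive_vec_nonzero: "positive_vec x \<Longrightarrow> x \<noteq> 0"
  unfolding positive_vec_def by (metis less_irrefl zero_index)

lemma sum_positive_vec_pos: "positive_vec x \<Longrightarrow> (\<Sum>j\<in>UNIV. x $ j) > 0"
  by (intro sum_pos) (auto simp: positive_vec_def)

lemma matrix_vector_mult_scaleR: "(Z :: real^'n::finite^'m) *v (t *\<^sub>R x) = t *\<^sub>R (Z *v x)"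
  by (simp add: matrix_vector_mult_def vec_eq_iff sum_distrib_left mult.left_commute)

definition eigen_moduli :: "real^'n::finite^'n \<Rightarrow> real set" where
  "eigen_moduli A = cmod ` {c. \<exists>v::complex^'n. v \<noteq> 0 \<and>
      (\<chi> i j. complex_of_real (A $ i $ j)) *v v = c *s v}"

lemma spectral_radius_eq_Sup: "spectral_radius A = Sup (eigen_moduli A)"
  unfolding spectral_radius_def eigen_moduli_def ..

text \<open>The Collatz--Wielandt bound.\<close>

lemma eigen_moduli_le:
  fixes Z :: "real^'n::finite^'n"
  assumes nonneg: "\<And>i j. Z $ i $ j \<ge> 0" and q: "positive_vec q"
    and sub: "\<And>i. (Z *v q) $ i \<le> \<rho> * q $ i" and "x \<in> eigen_moduli Z"
  shows "x \<le> \<rho>"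
proof -
  obtain c v where x: "x = cmod c" and "v \<noteq> 0"
    and ev: "(\<chi> i j. complex_of_real (Z $ i $ j)) *v v = c *s v"
    using \<open>x \<in> eigen_moduli Z\<close> unfolding eigen_moduli_def by blast
  have qpos: "q $ i > 0" for i
    using q by (simp add: positive_vec_def)
  \<comment> \<open>Compare with q at an index where the ratio |v_i| / q_i is maximal.\<close>
  define h where "h i = cmod (v $ i) / q $ i" for i
  have "Max (range h) \<in> range h"
    by (rule Max_in) auto
  then obtain i0 where i0: "h i0 = Max (range h)"
    by (metis imageE)
  have h_le: "h j \<le> h i0" for j
    using i0 by simp
  obtain j where "v $ j \<noteq> 0"
    using \<open>v \<noteq> 0\<close> by (metis vec_eq_iff zero_index)
  then have "h j > 0"
    using qpos[of j] by (simp add: h_def)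
  then have h0: "h i0 > 0"
    using h_le[of j] by linarith
  have v_le: "cmod (v $ j) \<le> h i0 * q $ j" for j
    using h_le[of j] qpos[of j] by (simp add: h_def field_simps)
  have v_i0: "cmod (v $ i0) = h i0 * q $ i0"
    using qpos[of i0] by (simp add: h_def)
  have "cmod c * cmod (v $ i0) = cmod (\<Sum>j\<in>UNIV. complex_of_real (Z $ i0 $ j) * v $ j)"
    using arg_cong[OF ev, of "\<lambda>w. cmod (w $ i0)"]
    by (simp add: matrix_vector_mult_def norm_mult)
  also have "\<dots> \<le> (\<Sum>j\<in>UNIV. Z $ i0 $ j * cmod (v $ j))"
    by (rule order_trans[OF norm_sum]) (simp add: norm_mult nonneg)
  also have "\<dots> \<le> (\<Sum>j\<in>UNIV. Z $ i0 $ j * (h i0 * q $ j))"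
    by (rule sum_mono) (simp add: mult_left_mono nonneg v_le)
  also have "\<dots> = h i0 * (Z *v q) $ i0"
    by (simp add: matrix_vector_mult_def sum_distrib_left algebra_simps)
  also have "\<dots> \<le> h i0 * (\<rho> * q $ i0)"
    using sub h0 by simp
  also have "\<dots> = \<rho> * cmod (v $ i0)"
    using v_i0 by simp
  finally show ?thesis
    using v_i0 h0 qpos[of i0] x by simp
qed

lemma positive_eigenvalue_in_eigen_moduli:
  fixes Z :: "real^'n::finite^'n"
  assumes "Z *v q = \<rho> *\<^sub>R q" "positive_vec q" "\<rho> \<ge> 0"
  shows "\<rho> \<in> eigen_moduli Z"
proof -
  define v :: "complex^'n" where "v = (\<chi> i. complex_of_real (q $ i))"
  have "v $ i \<noteq> 0" for i
    using assms(2) by (simp add: v_def positive_vec_def order_less_imp_not_eq2)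
  then have "v \<noteq> 0"
    by (metis zero_index)
  moreover have "(\<chi> i j. complex_of_real (Z $ i $ j)) *v v = complex_of_real \<rho> *s v"
  proof -
    have "(\<Sum>j\<in>UNIV. Z $ i $ j * q $ j) = \<rho> * q $ i" for i
      using arg_cong[OF assms(1), of "\<lambda>w. w $ i"] by (simp add: matrix_vector_mult_def)
    then show ?thesis
      by (simp add: matrix_vector_mult_def v_def vec_eq_iff flip: of_real_mult of_real_sum)
  qed
  ultimately show ?thesis
    using assms(3) unfolding eigen_moduli_def by (auto intro!: image_eqI[of _ _ "complex_of_real \<rho>"])
qed

lemma spectral_radius_le:
  fixes Z :: "real^'n::finite^'n"
  assumes "\<And>i j. Z $ i $ j \<ge> 0" "positive_vec q" "\<And>i. (Z *v q) $ i \<le> \<rho> * q $ i"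
    and "eigen_moduli Z \<noteq> {}"
  shows "spectral_radius Z \<le> \<rho>"
  unfolding spectral_radius_eq_Sup using assms eigen_moduli_le by (intro cSup_least) blast+

lemma spectral_radius_eq_positive_eigenvalue:
  fixes Z :: "real^'n::finite^'n"
  assumes "\<And>i j. Z $ i $ j \<ge> 0" "positive_vec q" "Z *v q = \<rho> *\<^sub>R q" "\<rho> \<ge> 0"
  shows "spectral_radius Z = \<rho>"
proof (rule antisym)
  have in_moduli: "\<rho> \<in> eigen_moduli Z"
    using assms(3,2,4) by (rule positive_eigenvalue_in_eigen_moduli)
  have sub: "(Z *v q) $ i \<le> \<rho> * q $ i" for i
    using assms(3) by simp
  show "spectral_radius Z \<le> \<rho>"
    using assms(1,2) sub in_moduli by (intro spectral_radius_le) auto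
  have "bdd_above (eigen_moduli Z)"
    using assms(1,2) sub by (intro bdd_aboveI) (rule eigen_moduli_le)
  then show "\<rho> \<le> spectral_radius Z"
    unfolding spectral_radius_eq_Sup using in_moduli by (rule cSup_upper[rotated])
qed

locale max_system =
  fixes Zs :: "(real^'n::finite^'n) set"
  assumes finite_Zs: "finite Zs" and Zs_nonempty: "Zs \<noteq> {}"
    and nonneg: "\<And>Z i j. Z \<in> Zs \<Longrightarrow> Z $ i $ j \<ge> 0"
    and row_max_attained: "\<And>x. \<exists>Z\<in>Zs. \<forall>Z'\<in>Zs. \<forall>i. (Z' *v x) $ i \<le> (Z *v x) $ i"
    and primitive: "primitive_set Zs"
begin

definition max_map :: "real^'n \<Rightarrow> real^'n" where
  "max_map x = (\<chi> i. Max ((\<lambda>Z. (Z *v x) $ i) ` Zs))"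

lemma le_max_map: "Z \<in> Zs \<Longrightarrow> (Z *v x) $ i \<le> max_map x $ i"
  unfolding max_map_def using finite_Zs by simp

lemma max_map_attained: "\<exists>Z\<in>Zs. max_map x = Z *v x"
proof -
  obtain Z where Z: "Z \<in> Zs" "\<forall>Z'\<in>Zs. \<forall>i. (Z' *v x) $ i \<le> (Z *v x) $ i"
    using row_max_attained by blast
  then have "max_map x $ i = (Z *v x) $ i" for i
    unfolding max_map_def using finite_Zs by (auto intro!: Max_eqI)
  with Z(1) show ?thesis
    by (auto simp: vec_eq_iff)
qed

lemma matrix_vector_mult_mono:
  "Z \<in> Zs \<Longrightarrow> (\<And>j. x $ j \<le> y $ j) \<Longrightarrow> (Z *v x) $ i \<le> (Z *v y) $ i"
  unfolding matrix_vector_mult_def using nonneg by (auto intro!: sum_mono mult_left_mono)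

lemma max_map_mono:
  assumes "\<And>j. x $ j \<le> y $ j"
  shows "max_map x $ i \<le> max_map y $ i"
proof -
  obtain Z where "Z \<in> Zs" "max_map x = Z *v x"
    using max_map_attained by blast
  then show ?thesis
    using matrix_vector_mult_mono[OF _ assms] le_max_map by (metis order_trans)
qed

lemma max_map_scaleR:
  assumes "t \<ge> 0"
  shows "max_map (t *\<^sub>R x) = t *\<^sub>R max_map x"
proof -
  have "Max ((\<lambda>Z. t * (Z *v x) $ i) ` Zs) = t * Max ((\<lambda>Z. (Z *v x) $ i) ` Zs)" for i
    using mono_Max_commute[of "(*) t" "(\<lambda>Z. (Z *v x) $ i) ` Zs"] assms finite_Zs Zs_nonempty
    by (simp add: mono_def mult_left_mono image_image)
  then show ?thesis
    by (simp add: max_map_def matrix_vector_mult_scaleR vec_eq_iff)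
qed

lemma max_map_tendsto:
  assumes "x \<longlonglongrightarrow> y"
  shows "(\<lambda>k. max_map (x k) $ i) \<longlonglongrightarrow> max_map y $ i"
proof -
  have "(\<lambda>k. (Z *v x k) $ i) \<longlonglongrightarrow> (Z *v y) $ i" for Z
    unfolding matrix_vector_mult_def
    by (simp, intro tendsto_sum tendsto_mult_left tendsto_vec_nth assms)
  then show ?thesis
    unfolding max_map_def using finite_Zs Zs_nonempty by (simp add: tendsto_Max_finite)
qed

definition prim_exp :: nat where
  "prim_exp = (SOME n. n > 0 \<and>
     (\<forall>Ms. length Ms = n \<and> set Ms \<subseteq> Zs \<longrightarrow> (\<forall>i j. foldr (**) Ms (mat 1) $ i $ j > 0)))"

lemma prim_exp:
  shows prim_exp_pos: "prim_exp > 0"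
    and prod_prim_exp_pos:
      "length Ms = prim_exp \<Longrightarrow> set Ms \<subseteq> Zs \<Longrightarrow> foldr (**) Ms (mat 1) $ i $ j > 0"
  using someI_ex[OF primitive[unfolded primitive_set_def]] unfolding prim_exp_def by blast+

lemma row_has_pos_entry:
  assumes "Z \<in> Zs"
  shows "\<exists>l. Z $ i $ l > 0"
proof (rule ccontr)
  assume "\<not> ?thesis"
  then have zero: "Z $ i $ l = 0" for l
    using nonneg[OF assms, of i l] by (meson antisym not_le)
  have "replicate prim_exp Z = Z # replicate (prim_exp - 1) Z"
    using prim_exp_pos by (cases prim_exp) auto
  then have "foldr (**) (replicate prim_exp Z) (mat 1) $ i $ i = 0"
    by (simp add: matrix_matrix_mult_def zero)
  moreover have "foldr (**) (replicate prim_exp Z) (mat 1) $ i $ i > 0"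
    using assms by (intro prod_prim_exp_pos) auto
  ultimately show False
    by simp
qed

lemma matrix_vector_mult_pos:
  assumes "Z \<in> Zs" "positive_vec x"
  shows "(Z *v x) $ i > 0"
proof -
  obtain l where "Z $ i $ l > 0"
    using row_has_pos_entry[OF assms(1)] by blast
  with assms(2) have "0 < Z $ i $ l * x $ l"
    by (simp add: positive_vec_def)
  also have "\<dots> \<le> (Z *v x) $ i"
    unfolding matrix_vector_mult_def using nonneg[OF assms(1)] assms(2)
    by (auto intro!: member_le_sum simp: positive_vec_def less_imp_le)
  finally show ?thesis .
qed

lemma max_map_positive: "positive_vec x \<Longrightarrow> positive_vec (max_map x)"
  using Zs_nonempty matrix_vector_mult_pos le_max_map unfolding positive_vec_def
  by (meson ex_in_conv order_less_le_trans)

lemma funpow_max_map_eq_prod: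
  "\<exists>Ms. set Ms \<subseteq> Zs \<and> length Ms = j \<and> (max_map ^^ j) x = foldr (**) Ms (mat 1) *v x"
proof (induction j)
  case 0
  show ?case by (intro exI[of _ "[]"]) simp
next
  case (Suc j)
  then obtain Ms where Ms: "set Ms \<subseteq> Zs" "length Ms = j"
    "(max_map ^^ j) x = foldr (**) Ms (mat 1) *v x"
    by blast
  obtain Z where "Z \<in> Zs" "max_map ((max_map ^^ j) x) = Z *v (max_map ^^ j) x"
    using max_map_attained by blast
  with Ms show ?case
    by (intro exI[of _ "Z # Ms"]) (simp add: matrix_vector_mul_assoc)
qed

lemma prod_le_funpow_max_map:
  "set Ms \<subseteq> Zs \<Longrightarrow> (foldr (**) Ms (mat 1) *v x) $ i \<le> (max_map ^^ length Ms) x $ i"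
proof (induction Ms arbitrary: i)
  case (Cons Z Ms)
  then have Z: "Z \<in> Zs"
    by simp
  have "(foldr (**) (Z # Ms) (mat 1) *v x) $ i = (Z *v (foldr (**) Ms (mat 1) *v x)) $ i"
    by (simp add: matrix_vector_mul_assoc)
  also have "\<dots> \<le> (Z *v (max_map ^^ length Ms) x) $ i"
    using Cons by (intro matrix_vector_mult_mono[OF Z]) auto
  also have "\<dots> \<le> (max_map ^^ length (Z # Ms)) x $ i"
    using le_max_map[OF Z] by simp
  finally show ?case .
qed simp

lemma funpow_max_map_scaleR: "t \<ge> 0 \<Longrightarrow> (max_map ^^ j) (t *\<^sub>R x) = t *\<^sub>R (max_map ^^ j) x"
  by (induction j) (auto simp: max_map_scaleR)

lemma funpow_max_map_positive: "positive_vec x \<Longrightarrow> positive_vec ((max_map ^^ j) x)"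
  by (induction j) (auto simp: max_map_positive)

definition blocks :: "(real^'n^'n) set" where
  "blocks = (\<lambda>Ms. foldr (**) Ms (mat 1)) ` {Ms. set Ms \<subseteq> Zs \<and> length Ms = prim_exp}"

definition block_entries :: "real set" where
  "block_entries = (\<lambda>(P, i, j). P $ i $ j) ` (blocks \<times> UNIV \<times> UNIV)"

definition block_min :: real where "block_min = Min block_entries"

definition block_max :: real where "block_max = Max block_entries"

abbreviation block_map :: "real^'n \<Rightarrow> real^'n" where
  "block_map \<equiv> max_map ^^ prim_exp"

lemma finite_block_entries: "finite block_entries"
  unfolding block_entries_def blocks_def using finite_lists_length_eq[OF finite_Zs] by simp

lemma block_entries_nonempty: "block_entries \<noteq> {}"
proof -
  obtain Z where "Z \<in> Zs"
    using Zs_nonempty by blast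
  then have "foldr (**) (replicate prim_exp Z) (mat 1) \<in> blocks"
    unfolding blocks_def by (intro imageI) auto
  then show ?thesis
    unfolding block_entries_def by blast
qed

lemma block_entry_bounds:
  assumes "P \<in> blocks"
  shows "block_min \<le> P $ i $ j" "P $ i $ j \<le> block_max"
proof -
  have "P $ i $ j \<in> block_entries"
    unfolding block_entries_def using assms by (intro image_eqI[of _ _ "(P, i, j)"]) auto
  then show "block_min \<le> P $ i $ j" "P $ i $ j \<le> block_max"
    unfolding block_min_def block_max_def using finite_block_entries by simp_all
qed

lemma block_min_pos: "block_min > 0"
proof -
  have "block_min \<in> block_entries"
    unfolding block_min_def using finite_block_entries block_entries_nonempty by (rule Min_in)
  then show ?thesis
    unfolding block_entries_def blocks_def using prod_prim_exp_pos by auto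
qed

lemma block_min_le_max: "block_min \<le> block_max"
  unfolding block_min_def block_max_def
  using finite_block_entries block_entries_nonempty by (simp add: Min_le Max_in)

lemma block_map_eq: "\<exists>P\<in>blocks. block_map x = P *v x"
  using funpow_max_map_eq_prod[of prim_exp x] unfolding blocks_def by blast

lemma block_map_le_sum:
  assumes "\<And>j. x $ j \<ge> 0"
  shows "block_map x $ i \<le> block_max * (\<Sum>j\<in>UNIV. x $ j)"
proof -
  obtain P where P: "P \<in> blocks" "block_map x = P *v x"
    using block_map_eq by blast
  have "(P *v x) $ i \<le> (\<Sum>j\<in>UNIV. block_max * x $ j)"
    unfolding matrix_vector_mult_def
    using block_entry_bounds(2)[OF P(1)] assms by (auto intro!: sum_mono mult_right_mono)
  with P(2) show ?thesis
    by (simp add: sum_distrib_left)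
qed

lemma block_map_gap:
  assumes "\<And>j. x $ j \<le> y $ j"
  shows "block_map x $ i + block_min * (\<Sum>j\<in>UNIV. y $ j - x $ j) \<le> block_map y $ i"
proof -
  obtain P where P: "P \<in> blocks" "block_map x = P *v x"
    using block_map_eq by blast
  have "block_map x $ i + block_min * (\<Sum>j\<in>UNIV. y $ j - x $ j)
      = (\<Sum>j\<in>UNIV. P $ i $ j * x $ j + block_min * (y $ j - x $ j))"
    using P(2) by (simp add: matrix_vector_mult_def sum_distrib_left sum.distrib)
  also have "\<dots> \<le> (\<Sum>j\<in>UNIV. P $ i $ j * x $ j + P $ i $ j * (y $ j - x $ j))"
    using block_entry_bounds(1)[OF P(1)] assms by (intro sum_mono) (simp add: mult_right_mono)
  also have "\<dots> = (P *v y) $ i"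
    by (simp add: matrix_vector_mult_def algebra_simps)
  also have "\<dots> \<le> block_map y $ i"
    using prod_le_funpow_max_map P(1) unfolding blocks_def by force
  finally show ?thesis .
qed

text \<open>The lower and upper Collatz--Wielandt ratios of \<open>x\<close>.\<close>

definition cw_lower :: "real^'n \<Rightarrow> real" where
  "cw_lower x = Min ((\<lambda>i. max_map x $ i / x $ i) ` UNIV)"

definition cw_upper :: "real^'n \<Rightarrow> real" where
  "cw_upper x = Max ((\<lambda>i. max_map x $ i / x $ i) ` UNIV)"

lemma cw_lower_le:
  assumes "positive_vec x"
  shows "cw_lower x * x $ i \<le> max_map x $ i"
proof -
  have "cw_lower x \<le> max_map x $ i / x $ i"
    unfolding cw_lower_def by (rule Min_le) auto
  with assms show ?thesis
    by (simp add: positive_vec_def pos_le_divide_eq)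
qed

lemma cw_upper_ge:
  assumes "positive_vec x"
  shows "max_map x $ i \<le> cw_upper x * x $ i"
proof -
  have "max_map x $ i / x $ i \<le> cw_upper x"
    unfolding cw_upper_def by (rule Max_ge) auto
  with assms show ?thesis
    by (simp add: positive_vec_def pos_divide_le_eq)
qed

lemma cw_lower_greatest: "positive_vec x \<Longrightarrow> (\<And>i. a * x $ i \<le> max_map x $ i) \<Longrightarrow> a \<le> cw_lower x"
  unfolding cw_lower_def by (auto intro!: Min.boundedI simp: positive_vec_def pos_le_divide_eq)

lemma cw_upper_least: "positive_vec x \<Longrightarrow> (\<And>i. max_map x $ i \<le> b * x $ i) \<Longrightarrow> cw_upper x \<le> b"
  unfolding cw_upper_def by (auto intro!: Max.boundedI simp: positive_vec_def divide_le_eq)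

lemma cw_lower_pos: "positive_vec x \<Longrightarrow> cw_lower x > 0"
  unfolding cw_lower_def using max_map_positive by (auto simp: positive_vec_def)

lemma cw_lower_le_upper:
  assumes "positive_vec x"
  shows "cw_lower x \<le> cw_upper x"
proof -
  have "cw_lower x * x $ undefined \<le> cw_upper x * x $ undefined"
    using cw_lower_le[OF assms] cw_upper_ge[OF assms] order_trans by blast
  moreover have "x $ undefined > 0"
    using assms by (simp add: positive_vec_def)
  ultimately show ?thesis
    by (rule mult_right_le_imp_le)
qed

lemma cw_lower_scaleR: "t > 0 \<Longrightarrow> cw_lower (t *\<^sub>R x) = cw_lower x"
  unfolding cw_lower_def by (simp add: max_map_scaleR)

lemma cw_upper_scaleR: "t > 0 \<Longrightarrow> cw_upper (t *\<^sub>R x) = cw_upper x"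
  unfolding cw_upper_def by (simp add: max_map_scaleR)

lemma cw_lower_max_map:
  assumes "positive_vec x"
  shows "cw_lower x \<le> cw_lower (max_map x)"
proof (rule cw_lower_greatest)
  show "positive_vec (max_map x)"
    using assms by (rule max_map_positive)
  fix i
  have "cw_lower x * max_map x $ i = max_map (cw_lower x *\<^sub>R x) $ i"
    using max_map_scaleR[of "cw_lower x" x] cw_lower_pos[OF assms] by simp
  also have "\<dots> \<le> max_map (max_map x) $ i"
    using cw_lower_le[OF assms] by (intro max_map_mono) simp
  finally show "cw_lower x * max_map x $ i \<le> max_map (max_map x) $ i" .
qed

lemma cw_upper_max_map:
  assumes "positive_vec x"
  shows "cw_upper (max_map x) \<le> cw_upper x"
proof (rule cw_upper_least)
  show "positive_vec (max_map x)"
    using assms by (rule max_map_positive)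
  fix i
  have "max_map (max_map x) $ i \<le> max_map (cw_upper x *\<^sub>R x) $ i"
    using cw_upper_ge[OF assms] by (intro max_map_mono) simp
  also have "\<dots> = cw_upper x * max_map x $ i"
    using max_map_scaleR[of "cw_upper x" x] cw_lower_pos[OF assms] cw_lower_le_upper[OF assms]
    by simp
  finally show "max_map (max_map x) $ i \<le> cw_upper x * max_map x $ i" .
qed

lemma Min_ratio_eq_inverse_cw_upper:
  assumes "positive_vec x"
  shows "Min ((\<lambda>i. x $ i / max_map x $ i) ` UNIV) = 1 / cw_upper x"
proof -
  have "x $ i / max_map x $ i = 1 / (max_map x $ i / x $ i)" for i
    by simp
  moreover have "max_map x $ i / x $ i > 0" for i
    using assms max_map_positive[OF assms] by (simp add: positive_vec_def)
  ultimately show ?thesis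
    unfolding cw_upper_def
    using Min_divide_eq_divide_Max[of UNIV "\<lambda>i. max_map x $ i / x $ i" 1] by simp
qed

lemma block_max_pos: "block_max > 0"
  using block_min_pos block_min_le_max by linarith

lemma cw_lower_block_map:
  assumes x: "positive_vec x"
  shows "cw_lower x + block_min * (\<Sum>j\<in>UNIV. max_map x $ j - cw_lower x * x $ j)
      / (block_max * (\<Sum>j\<in>UNIV. x $ j)) \<le> cw_lower (block_map x)"
proof -
  define m where "m = cw_lower x"
  define a where "a = (\<Sum>j\<in>UNIV. max_map x $ j - m * x $ j)"
  define s where "s = (\<Sum>j\<in>UNIV. x $ j)"
  define y where "y = block_map x"
  have "a \<ge> 0"
    unfolding a_def m_def using cw_lower_le[OF x] by (intro sum_nonneg) simp
  have "(m + block_min * a / (block_max * s)) * y $ i \<le> max_map y $ i" for i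
  proof -
    have "y $ i \<le> block_max * s"
      unfolding y_def s_def using x by (intro block_map_le_sum) (simp add: positive_vec_def less_imp_le)
    then have "y $ i / (block_max * s) \<le> 1"
      using block_max_pos sum_positive_vec_pos[OF x] by (simp add: s_def)
    then have "block_min * a * (y $ i / (block_max * s)) \<le> block_min * a"
      using block_min_pos \<open>a \<ge> 0\<close> by (intro mult_left_le) auto
    then have "block_min * a / (block_max * s) * y $ i \<le> block_min * a"
      by simp
    moreover have "block_map (m *\<^sub>R x) $ i + block_min * a \<le> block_map (max_map x) $ i"
      using block_map_gap[of "m *\<^sub>R x" "max_map x" i] cw_lower_le[OF x]
      unfolding a_def m_def by simp
    moreover have "block_map (m *\<^sub>R x) = m *\<^sub>R y" "block_map (max_map x) = max_map y"
      using cw_lower_pos[OF x] by (simp_all add: y_def m_def funpow_max_map_scaleR funpow_swap1)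
    ultimately show ?thesis
      by (simp add: algebra_simps)
  qed
  then show ?thesis
    using cw_lower_greatest[OF funpow_max_map_positive[OF x]]
    unfolding y_def m_def a_def s_def by blast
qed

lemma cw_upper_block_map:
  assumes x: "positive_vec x"
  shows "cw_upper (block_map x) \<le> cw_upper x - block_min * (\<Sum>j\<in>UNIV. cw_upper x * x $ j - max_map x $ j)
      / (block_max * (\<Sum>j\<in>UNIV. x $ j))"
proof -
  define M where "M = cw_upper x"
  define b where "b = (\<Sum>j\<in>UNIV. M * x $ j - max_map x $ j)"
  define s where "s = (\<Sum>j\<in>UNIV. x $ j)"
  define y where "y = block_map x"
  have "b \<ge> 0"
    unfolding b_def M_def using cw_upper_ge[OF x] by (intro sum_nonneg) simp
  have "max_map y $ i \<le> (M - block_min * b / (block_max * s)) * y $ i" for i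
  proof -
    have "y $ i \<le> block_max * s"
      unfolding y_def s_def using x by (intro block_map_le_sum) (simp add: positive_vec_def less_imp_le)
    then have "y $ i / (block_max * s) \<le> 1"
      using block_max_pos sum_positive_vec_pos[OF x] by (simp add: s_def)
    then have "block_min * b * (y $ i / (block_max * s)) \<le> block_min * b"
      using block_min_pos \<open>b \<ge> 0\<close> by (intro mult_left_le) auto
    then have "block_min * b / (block_max * s) * y $ i \<le> block_min * b"
      by simp
    moreover have "block_map (max_map x) $ i + block_min * b \<le> block_map (M *\<^sub>R x) $ i"
      using block_map_gap[of "max_map x" "M *\<^sub>R x" i] cw_upper_ge[OF x]
      unfolding b_def M_def by simp
    moreover have "block_map (M *\<^sub>R x) = M *\<^sub>R y" "block_map (max_map x) = max_map y"
      using cw_lower_pos[OF x] cw_lower_le_upper[OF x]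
      by (simp_all add: y_def M_def funpow_max_map_scaleR funpow_swap1)
    ultimately show ?thesis
      by (simp add: algebra_simps)
  qed
  then show ?thesis
    using cw_upper_least[OF funpow_max_map_positive[OF x]]
    unfolding y_def M_def b_def s_def by blast
qed

definition contraction :: real where
  "contraction = 1 - block_min / block_max"

lemma contraction_bounds: "0 \<le> contraction" "contraction < 1"
  using block_min_pos block_min_le_max by (auto simp: contraction_def)

lemma oscillation_block_map:
  assumes x: "positive_vec x"
  shows "cw_upper (block_map x) - cw_lower (block_map x) \<le> contraction * (cw_upper x - cw_lower x)"
proof -
  define m where "m = cw_lower x"
  define M where "M = cw_upper x"
  define s where "s = (\<Sum>j\<in>UNIV. x $ j)"
  have gaps: "(\<Sum>j\<in>UNIV. max_map x $ j - m * x $ j) + (\<Sum>j\<in>UNIV. M * x $ j - max_map x $ j)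
      = (M - m) * s"
    unfolding s_def by (simp add: sum_subtractf sum_distrib_left algebra_simps)
  have "cw_upper (block_map x) - cw_lower (block_map x)
      \<le> (M - m) - block_min * ((M - m) * s) / (block_max * s)"
    using cw_lower_block_map[OF x] cw_upper_block_map[OF x]
    unfolding m_def[symmetric] M_def[symmetric] s_def[symmetric] gaps[symmetric]
    by (simp add: add_divide_distrib distrib_left)
  also have "\<dots> = contraction * (M - m)"
    using sum_positive_vec_pos[OF x] block_max_pos
    by (simp add: s_def contraction_def field_simps)
  finally show ?thesis
    by (simp add: m_def M_def)
qed

end

locale max_iteration = max_system Zs for Zs :: "(real^'n::finite^'n) set" +
  fixes p :: "nat \<Rightarrow> real^'n"
  assumes p0_positive: "positive_vec (p 0)"
    and p_Suc: "\<And>k. p (Suc k) = (1 / norm (max_map (p k))) *\<^sub>R max_map (p k)"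
begin

lemma p_positive: "positive_vec (p k)"
proof (induction k)
  case (Suc k)
  then have "positive_vec (max_map (p k))"
    by (rule max_map_positive)
  then show ?case
    unfolding p_Suc by (simp add: positive_vec_scaleR positive_vec_nonzero)
qed (rule p0_positive)

lemma norm_max_map_p_pos: "norm (max_map (p k)) > 0"
  using positive_vec_nonzero[OF max_map_positive[OF p_positive]] by simp

lemma norm_p_Suc: "norm (p (Suc k)) = 1"
  using norm_max_map_p_pos[of k] by (simp add: p_Suc)

lemma p_add_eq_scaled_funpow: "\<exists>t>0. p (k + j) = t *\<^sub>R (max_map ^^ j) (p k)"
proof (induction j)
  case (Suc j)
  then obtain t where t: "t > 0" "p (k + j) = t *\<^sub>R (max_map ^^ j) (p k)"
    by blast
  define t' where "t' = t / norm (max_map (p (k + j)))"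
  have "p (k + Suc j) = t' *\<^sub>R (max_map ^^ Suc j) (p k)"
    using p_Suc[of "k + j"] t by (simp add: t'_def max_map_scaleR)
  moreover have "t' > 0"
    unfolding t'_def using t(1) norm_max_map_p_pos[of "k + j"] by simp
  ultimately show ?case
    by blast
qed (auto intro: exI[of _ 1])

lemma cw_lower_p_Suc: "cw_lower (p (Suc k)) = cw_lower (max_map (p k))"
  using norm_max_map_p_pos[of k] by (simp add: p_Suc cw_lower_scaleR)

lemma cw_upper_p_Suc: "cw_upper (p (Suc k)) = cw_upper (max_map (p k))"
  using norm_max_map_p_pos[of k] by (simp add: p_Suc cw_upper_scaleR)

lemma incseq_cw_lower: "incseq (\<lambda>k. cw_lower (p k))"
  by (rule incseq_SucI) (simp add: cw_lower_p_Suc cw_lower_max_map p_positive)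

lemma decseq_cw_upper: "decseq (\<lambda>k. cw_upper (p k))"
  by (rule decseq_SucI) (simp add: cw_upper_p_Suc cw_upper_max_map p_positive)

lemma cw_lower_p0_le: "cw_lower (p 0) \<le> cw_lower (p k)"
  using incseq_cw_lower by (simp add: incseq_def)

definition oscillation :: "nat \<Rightarrow> real" where
  "oscillation k = cw_upper (p k) - cw_lower (p k)"

lemma oscillation_nonneg: "oscillation k \<ge> 0"
  using cw_lower_le_upper[OF p_positive] by (simp add: oscillation_def)

lemma summable_oscillation: "summable oscillation"
proof (rule summable_if_contracting_after)
  show "decseq oscillation"
    using incseq_cw_lower decseq_cw_upper
    by (simp add: oscillation_def incseq_def decseq_def diff_mono)
  show "oscillation (k + prim_exp) \<le> contraction * oscillation k" for k
  proof -
    obtain t where "t > 0" "p (k + prim_exp) = t *\<^sub>R block_map (p k)"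
      using p_add_eq_scaled_funpow by blast
    then show ?thesis
      using oscillation_block_map[OF p_positive[of k]]
      by (simp add: oscillation_def cw_lower_scaleR cw_upper_scaleR)
  qed
qed (use oscillation_nonneg prim_exp_pos contraction_bounds in auto)

text \<open>After the first step the iterates lie on the unit sphere, which bounds the
  normalising factor between the two Collatz--Wielandt bounds.\<close>

lemma abs_ln_increment_le:
  assumes "k \<ge> 1"
  shows "\<bar>ln (p (Suc k) $ i) - ln (p k $ i)\<bar> \<le> oscillation k / cw_lower (p 0)"
proof -
  define y where "y = max_map (p k)"
  define m where "m = cw_lower (p k)"
  define M where "M = cw_upper (p k)"
  have pk: "p k $ j > 0" for j
    using p_positive by (simp add: positive_vec_def)
  have m: "0 < m" "m \<le> M"
    using cw_lower_pos cw_lower_le_upper p_positive by (simp_all add: m_def M_def)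
  have y_lo: "m * p k $ j \<le> y $ j" and y_hi: "y $ j \<le> M * p k $ j" for j
    using cw_lower_le cw_upper_ge p_positive by (simp_all add: m_def M_def y_def)
  have y_pos: "y $ j > 0" for j
    using y_lo[of j] m pk[of j] by (smt (verit) mult_pos_pos)
  have "norm (p k) = 1"
    using norm_p_Suc[of "k - 1"] assms by simp
  moreover have "norm (m *\<^sub>R p k) \<le> norm y"
    by (rule norm_le_componentwise_cart) (use y_lo y_pos m pk in \<open>simp add: abs_mult abs_of_pos\<close>)
  moreover have "norm y \<le> norm (M *\<^sub>R p k)"
    by (rule norm_le_componentwise_cart) (use y_hi y_pos m pk in \<open>simp add: abs_mult abs_of_pos\<close>)
  ultimately have norm_y: "m \<le> norm y" "norm y \<le> M"
    using m by simp_all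
  then have "norm y * p k $ i > 0"
    using m pk[of i] by (intro mult_pos_pos) linarith+
  have ratio: "p (Suc k) $ i / p k $ i = y $ i / (norm y * p k $ i)"
    by (simp add: p_Suc y_def)
  have "m / M \<le> p (Suc k) $ i / p k $ i"
  proof -
    have "(m * p k $ i) / (M * p k $ i) \<le> y $ i / (norm y * p k $ i)"
      using y_lo[of i] y_pos[of i] norm_y \<open>norm y * p k $ i > 0\<close> pk[of i] m
      by (intro frac_le) (auto intro: mult_right_mono)
    then show ?thesis
      using pk[of i] ratio by simp
  qed
  moreover have "p (Suc k) $ i / p k $ i \<le> M / m"
  proof -
    have "y $ i / (norm y * p k $ i) \<le> (M * p k $ i) / (m * p k $ i)"
      using y_hi[of i] norm_y pk[of i] m y_pos[of i]
      by (intro frac_le) (auto intro: mult_right_mono)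
    then show ?thesis
      using pk[of i] ratio by simp
  qed
  ultimately have "\<bar>ln (p (Suc k) $ i / p k $ i)\<bar> \<le> M / m - 1"
    using m by (intro abs_ln_le_ratio)
  moreover have "ln (p (Suc k) $ i / p k $ i) = ln (p (Suc k) $ i) - ln (p k $ i)"
  proof -
    have "p (Suc k) $ i > 0"
      using p_positive by (simp add: positive_vec_def)
    with pk[of i] show ?thesis
      by (simp add: ln_div)
  qed
  moreover have "M / m - 1 = oscillation k / m"
    using m by (simp add: oscillation_def m_def M_def field_simps)
  moreover have "oscillation k / m \<le> oscillation k / cw_lower (p 0)"
    using oscillation_nonneg[of k] cw_lower_p0_le[of k] cw_lower_pos[OF p0_positive]
    unfolding m_def by (intro frac_le) auto
  ultimately show ?thesis
    by simp
qed

lemma p_converges: "\<exists>q. positive_vec q \<and> p \<longlonglongrightarrow> q"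
proof -
  have "\<exists>L>0. (\<lambda>k. p k $ i) \<longlonglongrightarrow> L" for i
  proof (rule convergent_if_summable_ln_increments)
    show "p k $ i > 0" for k
      using p_positive by (simp add: positive_vec_def)
    have "summable (\<lambda>k. oscillation k / cw_lower (p 0))"
      using summable_oscillation by (rule summable_divide)
    then show "summable (\<lambda>k. ln (p (Suc k) $ i) - ln (p k $ i))"
      by (rule summable_comparison_test'[where N = 1]) (simp add: abs_ln_increment_le)
  qed
  then obtain q where "q $ i > 0" "(\<lambda>k. p k $ i) \<longlonglongrightarrow> q $ i" for i
    by (metis (no_types) vec_lambda_beta)
  then show ?thesis
    by (auto simp: positive_vec_def intro: vec_tendstoI)
qed

lemma iteration_limit:
  obtains \<rho> q where "\<rho> > 0" "positive_vec q" "max_map q = \<rho> *\<^sub>R q"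
    "(\<lambda>k. cw_upper (p k)) \<longlonglongrightarrow> \<rho>" "p \<longlonglongrightarrow> q"
proof -
  have bounded: "cw_lower (p 0) \<le> cw_upper (p k)" for k
    using cw_lower_p0_le cw_lower_le_upper[OF p_positive] order_trans by blast
  then obtain \<rho> where upper: "(\<lambda>k. cw_upper (p k)) \<longlonglongrightarrow> \<rho>"
    using decseq_convergent[OF decseq_cw_upper] by blast
  have "cw_lower (p 0) \<le> \<rho>"
    using upper by (rule LIMSEQ_le_const) (use bounded in blast)
  then have "\<rho> > 0"
    using cw_lower_pos[OF p0_positive] by linarith
  have lower: "(\<lambda>k. cw_lower (p k)) \<longlonglongrightarrow> \<rho>"
  proof -
    have "oscillation \<longlonglongrightarrow> 0"
      using summable_oscillation by (rule summable_LIMSEQ_zero)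
    then have "(\<lambda>k. cw_upper (p k) - oscillation k) \<longlonglongrightarrow> \<rho> - 0"
      by (intro tendsto_diff upper)
    then show ?thesis
      by (simp add: oscillation_def)
  qed
  obtain q where q: "positive_vec q" "p \<longlonglongrightarrow> q"
    using p_converges by blast
  have "max_map q $ i = \<rho> * q $ i" for i
  proof (rule antisym)
    have "(\<lambda>k. cw_upper (p k) * p k $ i) \<longlonglongrightarrow> \<rho> * q $ i"
      by (intro tendsto_mult upper tendsto_vec_nth q(2))
    then show "max_map q $ i \<le> \<rho> * q $ i"
      by (rule LIMSEQ_le[OF max_map_tendsto[OF q(2)]]) (simp add: cw_upper_ge p_positive)
    have "(\<lambda>k. cw_lower (p k) * p k $ i) \<longlonglongrightarrow> \<rho> * q $ i"
      by (intro tendsto_mult lower tendsto_vec_nth q(2))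
    then show "\<rho> * q $ i \<le> max_map q $ i"
      by (rule LIMSEQ_le[OF _ max_map_tendsto[OF q(2)]]) (simp add: cw_lower_le p_positive)
  qed
  then have "max_map q = \<rho> *\<^sub>R q"
    by (simp add: vec_eq_iff)
  with \<open>\<rho> > 0\<close> q upper show ?thesis
    using that by blast
qed

end

context max_system
begin

lemma singleton_max_system: "Z \<in> Zs \<Longrightarrow> max_system {Z}"
  by unfold_locales
    (auto simp: primitive_set_def nonneg intro!: exI[of _ prim_exp] prim_exp_pos prod_prim_exp_pos)

text \<open>Perron's theorem for a single matrix of the system, obtained by running the
  normalised power iteration on it.\<close>

lemma perron_eigenvector:
  assumes "Z \<in> Zs"
  obtains \<rho> q where "\<rho> > 0" "positive_vec q" "Z *v q = \<rho> *\<^sub>R q"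
proof -
  interpret S: max_system "{Z}"
    using assms by (rule singleton_max_system)
  define p where "p k = ((\<lambda>x. (1 / norm (S.max_map x)) *\<^sub>R S.max_map x) ^^ k) (\<chi> i. 1)" for k
  interpret I: max_iteration "{Z}" p
    using S.max_system_axioms
    by (simp add: max_iteration_def max_iteration_axioms_def p_def positive_vec_def)
  obtain \<rho> q where "\<rho> > 0" "positive_vec q" "S.max_map q = \<rho> *\<^sub>R q"
    using I.iteration_limit by blast
  moreover have "S.max_map q = Z *v q"
    using S.max_map_attained by blast
  ultimately show ?thesis
    using that by simp
qed

lemma Max_spectral_radius_eq:
  assumes "\<rho> > 0" "positive_vec q" "max_map q = \<rho> *\<^sub>R q"
  shows "Max (spectral_radius ` Zs) = \<rho>"
proof (rule Max_eqI)
  show "finite (spectral_radius ` Zs)"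
    using finite_Zs by simp
  have "spectral_radius Z \<le> \<rho>" if Z: "Z \<in> Zs" for Z
  proof (rule spectral_radius_le)
    obtain \<rho>' q' where "\<rho>' > 0" "positive_vec q'" "Z *v q' = \<rho>' *\<^sub>R q'"
      using perron_eigenvector[OF Z] .
    then show "eigen_moduli Z \<noteq> {}"
      using positive_eigenvalue_in_eigen_moduli by fastforce
    show "(Z *v q) $ i \<le> \<rho> * q $ i" for i
      using le_max_map[OF Z, of q i] assms(3) by simp
  qed (use nonneg Z assms(2) in auto)
  then show "y \<in> spectral_radius ` Zs \<Longrightarrow> y \<le> \<rho>" for y
    by blast
  obtain Z0 where "Z0 \<in> Zs" "max_map q = Z0 *v q"
    using max_map_attained by blast
  moreover from this have "spectral_radius Z0 = \<rho>"
    using assms nonneg by (intro spectral_radius_eq_positive_eigenvalue[of _ q]) auto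
  ultimately show "\<rho> \<in> spectral_radius ` Zs"
    by blast
qed

end

definition zmat :: "('n::finite \<Rightarrow> nat \<Rightarrow> 'n \<Rightarrow> real) \<Rightarrow> real^'n \<Rightarrow> ('n \<Rightarrow> nat) \<Rightarrow> real^'n^'n" where
  "zmat g mu \<kappa> = mat 1 - (\<chi> i. a_row g mu i (\<kappa> i))"

lemma Zset_eq_image_zmat: "Zset K g mu = zmat g mu ` {\<kappa>. \<forall>i. \<kappa> i < K i}"
  unfolding Zset_def Gset_def zmat_def by blast

lemma zmat_entry:
  "zmat g mu \<kappa> $ i $ j = (if j = i then 0 else mu $ i * g i (\<kappa> i) j / g i (\<kappa> i) i)"
  by (simp add: zmat_def mat_def a_row_def)

lemma zmat_mult_eq: "(zmat g mu \<kappa> *v x) $ i = (unit_vec i - a_row g mu i (\<kappa> i)) \<bullet> x"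
proof -
  have "zmat g mu \<kappa> $ i $ j = (unit_vec i - a_row g mu i (\<kappa> i)) $ j" for j
    by (simp add: zmat_entry unit_vec_def a_row_def)
  then show ?thesis
    by (simp add: matrix_vector_mult_def inner_vec_def)
qed

lemma row_inner_eq:
  "(unit_vec i - a_row g mu i k) \<bullet> x = mu $ i / g i k i * (\<Sum>j\<in>UNIV - {i}. g i k j * x $ j)"
proof -
  have "(unit_vec i - a_row g mu i k) \<bullet> x
      = (\<Sum>j\<in>UNIV. if j = i then 0 else mu $ i / g i k i * (g i k j * x $ j))"
    unfolding inner_vec_def unit_vec_def a_row_def by (intro sum.cong) auto
  also have "\<dots> = (\<Sum>j\<in>UNIV - {i}. mu $ i / g i k i * (g i k j * x $ j))"
    by (subst sum.remove[of UNIV i]) (auto intro!: sum.cong)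
  finally show ?thesis
    by (simp add: sum_distrib_left)
qed

lemma finite_choices: "finite {\<kappa>::'n::finite \<Rightarrow> nat. \<forall>i. \<kappa> i < K i}"
proof -
  have "{\<kappa>::'n \<Rightarrow> nat. \<forall>i. \<kappa> i < K i} = PiE UNIV (\<lambda>i. {..<K i})"
    by (auto simp: PiE_iff)
  then show ?thesis
    by (simp add: finite_PiE)
qed

locale multicast =
  fixes K :: "'n::finite \<Rightarrow> nat" and g :: "'n \<Rightarrow> nat \<Rightarrow> 'n \<Rightarrow> real" and mu :: "real^'n"
  assumes K_pos: "\<And>i. K i \<ge> 1"
    and g_nonneg: "\<And>i k j. k < K i \<Longrightarrow> g i k j \<ge> 0"
    and g_direct: "\<And>i k. k < K i \<Longrightarrow> g i k i > 0"
    and mu_pos: "\<And>i. mu $ i > 0"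
    and primitive_Zset: "primitive_set (Zset K g mu)"
begin

lemma zmat_single_choice_in_Zset: "k < K i \<Longrightarrow> zmat g mu ((\<lambda>_. 0)(i := k)) \<in> Zset K g mu"
  using K_pos by (auto simp: Zset_eq_image_zmat Suc_le_eq)

lemma row_max_choice:
  "\<exists>k<K i. \<forall>k'<K i. (unit_vec i - a_row g mu i k') \<bullet> x \<le> (unit_vec i - a_row g mu i k) \<bullet> x"
proof -
  let ?R = "\<lambda>k. (unit_vec i - a_row g mu i k) \<bullet> x"
  have "Max (?R ` {..<K i}) \<in> ?R ` {..<K i}"
    using K_pos[of i] by (intro Max_in) (auto simp: lessThan_empty_iff)
  then obtain k where k: "k < K i" "?R k = Max (?R ` {..<K i})"
    by auto
  have "?R k' \<le> ?R k" if "k' < K i" for k'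
    unfolding k(2) using that by (intro Max_ge) auto
  with k(1) show ?thesis
    by blast
qed

sublocale max_system "Zset K g mu"
proof
  show "finite (Zset K g mu)"
    unfolding Zset_eq_image_zmat by (intro finite_imageI finite_choices)
  show "Zset K g mu \<noteq> {}"
    using K_pos by (auto simp: Zset_eq_image_zmat Suc_le_eq intro!: exI[of _ "\<lambda>_. 0"])
  show "Z $ i $ j \<ge> 0" if Z: "Z \<in> Zset K g mu" for Z i j
  proof -
    obtain \<kappa> where \<kappa>: "\<forall>i. \<kappa> i < K i" "Z = zmat g mu \<kappa>"
      using Z unfolding Zset_eq_image_zmat by blast
    have "0 \<le> mu $ i * g i (\<kappa> i) j"
      using mu_pos[of i] g_nonneg[of "\<kappa> i" i j] \<kappa>(1) by simp
    moreover have "0 < g i (\<kappa> i) i"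
      using g_direct \<kappa>(1) by simp
    ultimately show ?thesis
      unfolding \<kappa>(2) zmat_entry by simp
  qed
  show "\<exists>Z\<in>Zset K g mu. \<forall>Z'\<in>Zset K g mu. \<forall>i. (Z' *v x) $ i \<le> (Z *v x) $ i" for x
  proof -
    have "\<forall>i. \<exists>k<K i. \<forall>k'<K i.
        (unit_vec i - a_row g mu i k') \<bullet> x \<le> (unit_vec i - a_row g mu i k) \<bullet> x"
      using row_max_choice by blast
    then obtain \<kappa> where \<kappa>: "\<forall>i. \<kappa> i < K i \<and> (\<forall>k'<K i.
        (unit_vec i - a_row g mu i k') \<bullet> x \<le> (unit_vec i - a_row g mu i (\<kappa> i)) \<bullet> x)"
      by (rule choice[THEN exE])
    have "(Z' *v x) $ i \<le> (zmat g mu \<kappa> *v x) $ i" if "Z' \<in> Zset K g mu" for Z' i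
      using that \<kappa> unfolding Zset_eq_image_zmat by (auto simp: zmat_mult_eq)
    moreover have "zmat g mu \<kappa> \<in> Zset K g mu"
      using \<kappa> unfolding Zset_eq_image_zmat by blast
    ultimately show ?thesis
      by blast
  qed
  show "primitive_set (Zset K g mu)"
    by (rule primitive_Zset)
qed

lemma yvec_eq_max_map: "yvec K g mu x = max_map x"
proof -
  have "(\<lambda>Z. (Z *v x) $ i) ` Zset K g mu = (\<lambda>k. (unit_vec i - a_row g mu i k) \<bullet> x) ` {..<K i}" for i
  proof
    show "(\<lambda>Z. (Z *v x) $ i) ` Zset K g mu \<subseteq> (\<lambda>k. (unit_vec i - a_row g mu i k) \<bullet> x) ` {..<K i}"
      by (auto simp: Zset_eq_image_zmat zmat_mult_eq)
    show "(\<lambda>k. (unit_vec i - a_row g mu i k) \<bullet> x) ` {..<K i} \<subseteq> (\<lambda>Z. (Z *v x) $ i) ` Zset K g mu"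
    proof
      fix y
      assume "y \<in> (\<lambda>k. (unit_vec i - a_row g mu i k) \<bullet> x) ` {..<K i}"
      then obtain k where "k < K i" "y = (unit_vec i - a_row g mu i k) \<bullet> x"
        by auto
      then show "y \<in> (\<lambda>Z. (Z *v x) $ i) ` Zset K g mu"
        using zmat_single_choice_in_Zset
        by (intro image_eqI[of _ _ "zmat g mu ((\<lambda>_. 0)(i := k))"]) (simp_all add: zmat_mult_eq)
    qed
  qed
  then show ?thesis
    by (simp add: yvec_def max_map_def)
qed

lemma beta_of_eq: "positive_vec x \<Longrightarrow> beta_of K g mu x = 1 / cw_upper x"
  unfolding beta_of_def yvec_eq_max_map by (rule Min_ratio_eq_inverse_cw_upper)

lemma row_inner_pos:
  assumes "k < K i" "positive_vec x"
  shows "(unit_vec i - a_row g mu i k) \<bullet> x > 0"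
  using matrix_vector_mult_pos[OF zmat_single_choice_in_Zset[OF assms(1)] assms(2), of i]
  by (simp add: zmat_mult_eq)

lemma sinr_k_scaled_tendsto:
  assumes "k < K i" "positive_vec q"
  shows "((\<lambda>\<alpha>. sinr_k g sigma2 (\<alpha> *\<^sub>R q) i k)
    \<longlongrightarrow> mu $ i * q $ i / ((unit_vec i - a_row g mu i k) \<bullet> q)) at_top"
proof -
  define S where "S = (\<Sum>j\<in>UNIV - {i}. g i k j * q $ j)"
  have R: "(unit_vec i - a_row g mu i k) \<bullet> q = mu $ i / g i k i * S"
    unfolding S_def by (rule row_inner_eq)
  have "S > 0"
    using row_inner_pos[OF assms] mu_pos[of i] g_direct[OF assms(1)] unfolding R
    by (simp add: zero_less_mult_iff zero_less_divide_iff)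
  have "sinr_k g sigma2 (\<alpha> *\<^sub>R q) i k = g i k i * q $ i * \<alpha> / (\<alpha> * S + sigma2)" for \<alpha>
    by (simp add: sinr_k_def S_def sum_distrib_left mult_ac)
  moreover have "((\<lambda>\<alpha>. g i k i * q $ i * \<alpha> / (\<alpha> * S + sigma2)) \<longlongrightarrow> g i k i * q $ i * inverse S) at_top"
    using \<open>S > 0\<close> by real_asymp
  moreover have "g i k i * q $ i * inverse S = mu $ i * q $ i / ((unit_vec i - a_row g mu i k) \<bullet> q)"
    using mu_pos[of i] g_direct[OF assms(1)] \<open>S > 0\<close> unfolding R by (simp add: field_simps)
  ultimately show ?thesis
    by simp
qed

lemma Gamma_scaled_tendsto:
  assumes q: "positive_vec q" and "yvec K g mu q = \<rho> *\<^sub>R q" "\<rho> > 0"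
  shows "((\<lambda>\<alpha>. Gamma K g sigma2 (\<alpha> *\<^sub>R q)) \<longlongrightarrow> (1 / \<rho>) *\<^sub>R mu) at_top"
proof (rule vec_tendstoI)
  fix i
  let ?R = "\<lambda>k. (unit_vec i - a_row g mu i k) \<bullet> q"
  have K_ne: "{..<K i} \<noteq> {}"
    using K_pos[of i] by (auto simp: lessThan_empty_iff)
  have "((\<lambda>\<alpha>. sinr K g sigma2 (\<alpha> *\<^sub>R q) i) \<longlongrightarrow> Min ((\<lambda>k. mu $ i * q $ i / ?R k) ` {..<K i})) at_top"
    unfolding sinr_def using K_ne sinr_k_scaled_tendsto[OF _ q] by (intro tendsto_Min_finite) auto
  also have "Min ((\<lambda>k. mu $ i * q $ i / ?R k) ` {..<K i}) = mu $ i * q $ i / Max (?R ` {..<K i})"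
    using K_ne row_inner_pos[OF _ q] mu_pos[of i] q
    by (intro Min_divide_eq_divide_Max) (auto simp: positive_vec_def less_imp_le)
  also have "Max (?R ` {..<K i}) = \<rho> * q $ i"
    using arg_cong[OF assms(2), of "\<lambda>y. y $ i"] by (simp add: yvec_def)
  also have "mu $ i * q $ i / (\<rho> * q $ i) = (1 / \<rho>) * mu $ i"
    using q[unfolded positive_vec_def, rule_format, of i] by simp
  finally show "((\<lambda>\<alpha>. Gamma K g sigma2 (\<alpha> *\<^sub>R q) $ i) \<longlongrightarrow> ((1 / \<rho>) *\<^sub>R mu) $ i) at_top"
    by (simp add: Gamma_def)
qed

end

theorem theorem3:
  fixes K :: "'n::finite \<Rightarrow> nat"
    and g :: "'n \<Rightarrow> nat \<Rightarrow> 'n \<Rightarrow> real"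
    and sigma2 :: real
    and mu :: "real^'n"
    and p :: "nat \<Rightarrow> real^'n"
  assumes K_pos: "\<forall>i. K i \<ge> 1"
    and g_nonneg: "\<forall>i k j. k < K i \<longrightarrow> g i k j \<ge> 0"
    and g_direct: "\<forall>i k. k < K i \<longrightarrow> g i k i > 0"
    and sigma_pos: "sigma2 > 0"
    and mu_pos: "\<forall>i. mu $ i > 0"
    and irred: "\<forall>Z\<in>Zset K g mu. irreducible_mat Z"
    and prim: "primitive_set (Zset K g mu)"
    and p0: "\<forall>i. p 0 $ i > 0"
    and p_step: "\<forall>k. p (Suc k) = (1 / norm (yvec K g mu (p k))) *\<^sub>R yvec K g mu (p k)"
  shows "(\<lambda>k. beta_of K g mu (p k)) \<longlonglongrightarrow> 1 / Max (spectral_radius ` Zset K g mu)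
    \<and> (\<exists>pstar. p \<longlonglongrightarrow> pstar \<and>
         ((\<lambda>\<alpha>. Gamma K g sigma2 (\<alpha> *\<^sub>R pstar))
            \<longlongrightarrow> (1 / Max (spectral_radius ` Zset K g mu)) *\<^sub>R mu) at_top)"
proof -
  interpret multicast K g mu
    using K_pos g_nonneg g_direct mu_pos prim by unfold_locales auto
  interpret max_iteration "Zset K g mu" p
    using max_system_axioms p0 p_step
    by (simp add: max_iteration_def max_iteration_axioms_def positive_vec_def yvec_eq_max_map)
  obtain \<rho> q where \<rho>: "\<rho> > 0" "positive_vec q" "max_map q = \<rho> *\<^sub>R q"
    and upper: "(\<lambda>k. cw_upper (p k)) \<longlonglongrightarrow> \<rho>" and "p \<longlonglongrightarrow> q"
    by (rule iteration_limit)
  have "Max (spectral_radius ` Zset K g mu) = \<rho>"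
    using \<rho> by (rule Max_spectral_radius_eq)
  moreover have "(\<lambda>k. beta_of K g mu (p k)) \<longlonglongrightarrow> 1 / \<rho>"
    unfolding beta_of_eq[OF p_positive] using upper \<rho>(1) by (intro tendsto_divide tendsto_const) auto
  moreover have "((\<lambda>\<alpha>. Gamma K g sigma2 (\<alpha> *\<^sub>R q)) \<longlongrightarrow> (1 / \<rho>) *\<^sub>R mu) at_top"
    using \<rho> by (intro Gamma_scaled_tendsto) (simp_all add: yvec_eq_max_map)
  ultimately show ?thesis
    using \<open>p \<longlonglongrightarrow> q\<close> by auto
qed

end
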